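(* Let $n\ge 1$ and let $A_n=(n,f_n)$ be an NCCA. Every bundle tree $T_{A_n}$ of $A_n$ is a binary tree whose root (first level) is $P_1=\{1\}$, i.e. the root vertex is the length-one pattern $1$.
   Context: A (1-dimensional, 2-state) cellular automaton (CA) of neighborhood size $n\ge 1$ (an $n$-cell CA) is a pair $A=(n,f)$ with local function $f:\{0,1\}^n\to\{0,1\}$. Its global function $F$ acts on configurations $c:\mathbb{Z}\to\{0,1\}$ by $F(c)(i)=f(c(i)c(i+1)\cdots c(i+n-1))$. $A$ is number-conserving (an NCCA) if for every finite configuration $c$ (finitely many cells in state $1$), $F(c)$ is also finite and $\sum_{i\in\mathbb{Z}}(F(c)(i)-c(i))=0$, i.e. $c$ and $F(c)$ have the same number of 1s. The value-1 pattern set of $A=(n,f)$ is $P_A=\{p\in\{0,1\}^n : f(p)=1\}$. Let $P\subseteq\{0,1\}^m$ with $m\ge 2$. Two patterns $p,q\in P$ can be paired if $\{p,q\}=\{0r,1r\}$ or $\{p,q\}=\{r0,r1\}$ for some $r\in\{0,1\}^{m-1}$; this (unique) $r$ is called the bundle pattern of the pair. A bundle pattern set of $P$ is a set $\hat P\subseteq\{0,1\}^{m-1}$ for which there is a partition of $P$ into two-element sets $\{p,q\}$ that can be paired such that $\hat P$ is the set of the bundle patterns of these pairs. Bundle tree: let $A_n=(n,f_n)$ be an NCCA and let $P_n$ be its value-1 pattern set. Suppose $P_n,P_{n-1},\dots,P_1$ is a sequence with $P_i\subseteq\{0,1\}^i$ and $|P_i|=2^{i-1}$ for $1\le i\le n$,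 and such that $P_{i-1}$ is a bundle pattern set of $P_i$ for $2\le i\le n$, with a fixed partition of $P_i$ into pairs realizing it. Then each $r\in P_i$ ($1\le i\le n-1$) is the bundle pattern of exactly one pair $\{p,q\}$ of the partition of $P_{i+1}$. The associated bundle tree $T_{A_n}=(V,E)$ of $A_n$ is the graph whose vertex set $V$ is the union of all $P_i$, $1\le i\le n$, and whose edges are all $(r,p)$ and $(r,q)$ (from parent $r$ to children $p$, $q$) with $r\in P_i$, $1\le i\le n-1$, and $\{p,q\}$ the pair of the partition of $P_{i+1}$ with bundle pattern $r$. The $i$-th level of the tree is $P_i$, and the first level $P_1$ is the root level. *)

theory Defs
  imports
    "HOL-Library.Disjoint_Sets"
    "HOL-Library.Groups_Big_Fun"
    "Graph_Theory.Pair_Digraph"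
begin

text \<open>
  The states 0 and 1 are represented by \<^const>\<open>False\<close> and \<^const>\<open>True\<close>, and a pattern in
  \<open>{0,1}\<close>-to-the-\<open>m\<close> by a list of Booleans of length \<open>m\<close>. A cellular automaton is given by its
  neighbourhood size \<open>n\<close> and local function \<open>f\<close>; the values of \<open>f\<close> on lists of length other
  than \<open>n\<close> play no role.
\<close>

definition patterns :: "nat \<Rightarrow> bool list set" where
  "patterns m = {p. length p = m}"

type_synonym configuration = "int \<Rightarrow> bool"

definition finite_configuration :: "configuration \<Rightarrow> bool" where
  "finite_configuration c \<longleftrightarrow> finite {i. c i}"

definition global_function :: "nat \<Rightarrow> (bool list \<Rightarrow> bool) \<Rightarrow> configuration \<Rightarrow> configuration" where
  "global_function n f c = (\<lambda>i. f (map (\<lambda>j. c (i + int j)) [0..<n]))"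

text \<open>
  \<^const>\<open>Sum_any\<close> is the sum over the whole type. Its convention of returning 0 on a function with
  infinite support is harmless below, since both configurations are required to be finite.
\<close>

definition ncca :: "nat \<Rightarrow> (bool list \<Rightarrow> bool) \<Rightarrow> bool" where
  "ncca n f \<longleftrightarrow>
     (\<forall>c. finite_configuration c \<longrightarrow>
        finite_configuration (global_function n f c) \<and>
        Sum_any (\<lambda>i. of_bool (global_function n f c i) - of_bool (c i) :: int) = 0)"

definition value1_patterns :: "nat \<Rightarrow> (bool list \<Rightarrow> bool) \<Rightarrow> bool list set" where
  "value1_patterns n f = {p \<in> patterns n. f p}"

definition is_bundle_pattern :: "bool list \<Rightarrow> bool list set \<Rightarrow> bool" where
  "is_bundle_pattern r e \<longleftrightarrow> e = {False # r, True # r} \<or> e = {r @ [False], r @ [True]}"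

definition can_be_paired :: "bool list \<Rightarrow> bool list \<Rightarrow> bool" where
  "can_be_paired p q \<longleftrightarrow> (\<exists>r. is_bundle_pattern r {p, q})"

definition pairing :: "bool list set \<Rightarrow> bool list set set \<Rightarrow> bool" where
  "pairing P M \<longleftrightarrow>
     partition_on P M \<and> (\<forall>e\<in>M. \<exists>p q. p \<noteq> q \<and> e = {p, q} \<and> can_be_paired p q)"

text \<open>
  \<open>R\<close> is a bundle pattern set of \<open>P\<close>, realised by the partition \<open>M\<close> of \<open>P\<close> into pairs.
\<close>

definition bundle_pattern_set_via :: "bool list set set \<Rightarrow> bool list set \<Rightarrow> bool list set \<Rightarrow> bool"
where
  "bundle_pattern_set_via M P R \<longleftrightarrow>
     pairing P M \<and> R = {r. \<exists>e\<in>M. is_bundle_pattern r e}"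

text \<open>
  \<open>P i\<close> is the \<open>i\<close>-th level and \<open>M i\<close> the fixed partition of \<open>P i\<close> into pairs. Only the indices
  from 1 to \<open>n\<close> for \<open>P\<close>, and from 2 to \<open>n\<close> for \<open>M\<close>, are meaningful.
\<close>

definition bundle_sequence ::
  "nat \<Rightarrow> (bool list \<Rightarrow> bool) \<Rightarrow> (nat \<Rightarrow> bool list set) \<Rightarrow> (nat \<Rightarrow> bool list set set) \<Rightarrow> bool"
where
  "bundle_sequence n f P M \<longleftrightarrow>
     P n = value1_patterns n f \<and>
     (\<forall>i\<in>{1..n}. P i \<subseteq> patterns i \<and> card (P i) = 2 ^ (i - 1)) \<and>
     (\<forall>i\<in>{2..n}. bundle_pattern_set_via (M i) (P i) (P (i - 1)))"

definition bundle_graph ::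
  "nat \<Rightarrow> (nat \<Rightarrow> bool list set) \<Rightarrow> (nat \<Rightarrow> bool list set set) \<Rightarrow> bool list pair_pre_digraph"
where
  "bundle_graph n P M =
     \<lparr> pverts = (\<Union>i\<in>{1..n}. P i),
       parcs = {(r, p). \<exists>i\<in>{1..<n}. r \<in> P i \<and> (\<exists>e\<in>M (Suc i). is_bundle_pattern r e \<and> p \<in> e)} \<rparr>"

text \<open>\<open>T\<close> is a bundle tree, with levels \<open>P\<close>, of the automaton given by \<open>n\<close> and \<open>f\<close>.\<close>

definition is_bundle_tree ::
  "nat \<Rightarrow> (bool list \<Rightarrow> bool) \<Rightarrow> (nat \<Rightarrow> bool list set) \<Rightarrow> bool list pair_pre_digraph \<Rightarrow> bool"
where
  "is_bundle_tree n f P T \<longleftrightarrow> (\<exists>M. bundle_sequence n f P M \<and> T = bundle_graph n P M)"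

text \<open>
  A finite rooted tree with arcs directed away from the root (there is exactly one walk from the
  root to each vertex, which also excludes cycles), in which no vertex has more than two children.
\<close>

definition binary_tree :: "('a, 'b) pre_digraph \<Rightarrow> 'a \<Rightarrow> bool" where
  "binary_tree G v0 \<longleftrightarrow>
     fin_digraph G \<and> v0 \<in> verts G \<and>
     (\<forall>v\<in>verts G. \<exists>!w. pre_digraph.awalk G v0 w v) \<and>
     (\<forall>v\<in>verts G. out_degree G v \<le> 2)"

end

theory Submission
  imports Defs
begin

text \<open>
  Each of the two pairs with the all-zero bundle pattern contains the longer all-zero pattern, so if
  \<open>0\<close> were the root then the all-zero pattern of length \<open>n\<close> would have value 1 and the zero
  configuration would have an infinite image. Since the size doubles from each level to the next,
  each vertex is the bundle pattern of exactly one pair, hence has two children, and each vertex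
  below the root has exactly one parent.
\<close>

section \<open>Unique walks from the root of a ranked digraph\<close>

text \<open>A walk can be traced back from its end: the only arc into a vertex other than
  \<open>x\<close> starts at a vertex of smaller rank \<open>h\<close>, so induction on the rank
  applies, and the trace can stop only at \<open>x\<close>.\<close>

lemma ex1_awalk_from_root:
  fixes h :: "'a \<Rightarrow> nat"
  assumes wf: "wf_digraph G" and root: "x \<in> verts G"
    and rank: "\<And>a. a \<in> arcs G \<Longrightarrow> h (head G a) = Suc (h (tail G a))"
    and root_min: "\<And>v. v \<in> verts G \<Longrightarrow> h x \<le> h v"
    and in_arc: "\<And>v. v \<in> verts G \<Longrightarrow> v \<noteq> x \<Longrightarrow> \<exists>!a. a \<in> arcs G \<and> head G a = v"
    and v: "v \<in> verts G"
  shows "\<exists>!w. pre_digraph.awalk G x w v"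
proof -
  interpret wf_digraph G by (fact wf)
  have snoc: "awalk x (w @ [a]) u \<longleftrightarrow> a \<in> arcs G \<and> head G a = u \<and> awalk x w (tail G a)"
    for w a u
    by (auto simp: awalk_simps)
  \<comment> \<open>The tail of an arc into \<open>x\<close> would have rank below the minimum
    \<open>h x\<close>. Hence only the empty walk leads from \<open>x\<close> to itself.\<close>
  have no_arc_to_root: "head G a \<noteq> x" if "a \<in> arcs G" for a
    using rank[OF that] root_min[of "tail G a"] that by auto
  show ?thesis
    using v
  proof (induction "h v" arbitrary: v rule: less_induct)
    case less
    show ?case
    proof (cases "v = x")
      case True
      have "w = []" if "awalk x w x" for w
        using that no_arc_to_root by (cases w rule: rev_cases) (auto simp: snoc simp del: awalk_append_iff)
      moreover have "awalk x [] x"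
        using root by (simp add: awalk_Nil_iff)
      ultimately show ?thesis
        using True by blast
    next
      case False
      obtain a where a: "a \<in> arcs G" "head G a = v"
        and uniq: "\<And>b. b \<in> arcs G \<Longrightarrow> head G b = v \<Longrightarrow> b = a"
        using in_arc[OF less.prems False] by blast
      obtain w where w: "awalk x w (tail G a)"
        and w_uniq: "\<And>w'. awalk x w' (tail G a) \<Longrightarrow> w' = w"
        using less.hyps[of "tail G a"] a rank[of a] by auto
      have "u = w @ [a]" if "awalk x u v" for u
      proof (cases u rule: rev_cases)
        case Nil
        then show ?thesis
          using that False by (simp add: awalk_Nil_iff)
      next
        case (snoc u' b)
        then have "b \<in> arcs G" "head G b = v" "awalk x u' (tail G b)"
          using that \<open>awalk x (u' @ [b]) v \<longleftrightarrow> _\<close> by simp_all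
        then show ?thesis
          using uniq w_uniq snoc by metis
      qed
      moreover have "awalk x (w @ [a]) v"
        using a w snoc by blast
      ultimately show ?thesis
        by blast
    qed
  qed
qed

section \<open>Bundle patterns and pairings\<close>

text \<open>The first letters tell the two kinds of pair apart: a pair that varies in front shows
  both letters there, while one that varies at the end starts with the common letter
  \<open>hd r\<close>, which exists for \<open>r \<noteq> []\<close>. Dropping the varying letter
  then recovers the pattern.\<close>

lemma is_bundle_pattern_unique:
  assumes "is_bundle_pattern r e" and "is_bundle_pattern s e" and "r \<noteq> []"
  shows "r = s"
proof -
  \<comment> \<open>Comparing lengths transfers nonemptiness from \<open>r\<close> to
    \<open>s\<close>, so that \<open>shape\<close> applies to both.\<close>
  have "length ` e = {Suc (length t)}" if "is_bundle_pattern t e" for t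
    using that unfolding is_bundle_pattern_def by auto
  then have "length s = length r"
    using assms(1,2) by (metis singleton_inject nat.inject)
  then have "s \<noteq> []"
    using assms(3) by auto
  have shape: "(hd ` e = {False, True} \<and> tl ` e = {t}) \<or> (hd ` e = {hd t} \<and> butlast ` e = {t})"
    if "is_bundle_pattern t e" "t \<noteq> []" for t
    using that(1) unfolding is_bundle_pattern_def by (rule disj_forward) (simp_all add: that(2))
  have "{False, True} \<noteq> {b}" for b
    by auto
  then show ?thesis
    using shape[OF assms(1,3)] shape[OF assms(2) \<open>s \<noteq> []\<close>] by (metis singleton_inject)
qed

lemma card_is_bundle_pattern:
  assumes "is_bundle_pattern r e"
  shows "card e = 2"
  using assms unfolding is_bundle_pattern_def by auto

lemma replicate_False_mem:
  assumes "is_bundle_pattern (replicate i False) e"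
  shows "replicate (Suc i) False \<in> e"
  using assms unfolding is_bundle_pattern_def by (auto simp: replicate_append_same)

lemma pairing_has_bundle_pattern:
  assumes "pairing P M" and "e \<in> M"
  shows "\<exists>r. is_bundle_pattern r e"
  using assms unfolding pairing_def can_be_paired_def by metis

lemma card_pairing:
  assumes "pairing P M" and "finite P"
  shows "card P = 2 * card M"
proof -
  have part: "partition_on P M"
    using assms(1) by (simp add: pairing_def)
  then have "finite M"
    using assms(2) finite_elements by blast
  have "2 * card M = card (\<Union>M)"
    using \<open>finite M\<close> part assms
    by (intro card_partition)
       (auto simp: partition_on_def disjoint_def
             dest!: pairing_has_bundle_pattern intro: card_is_bundle_pattern)
  then show ?thesis
    using part by (simp add: partition_on_def)
qed

text \<open>A counting argument: taking bundle patterns maps \<open>M\<close> onto \<open>R\<close>,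
  and both have half as many elements as \<open>P\<close>, so this map between finite sets is
  injective.\<close>

lemma bundle_pattern_set_inj:
  assumes via: "bundle_pattern_set_via M P R"
    and fin: "finite P" and card: "card P = 2 * card R" and ne: "[] \<notin> R"
    and e: "e \<in> M" "is_bundle_pattern r e" and e': "e' \<in> M" "is_bundle_pattern r e'"
  shows "e = e'"
proof -
  have pair: "pairing P M" and R: "R = {r. \<exists>e\<in>M. is_bundle_pattern r e}"
    using via by (auto simp: bundle_pattern_set_via_def)
  have "finite M"
    using pair fin finite_elements unfolding pairing_def by blast
  \<comment> \<open>The choice is forced on \<open>M\<close>: each block has a bundle pattern, and
    it is unique because it lies in \<open>R\<close> and so is nonempty.\<close>
  define b where "b e = (SOME r. is_bundle_pattern r e)" for e
  have b: "b e = r" if "e \<in> M" "is_bundle_pattern r e" for e r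
  proof -
    have "is_bundle_pattern (b e) e"
      unfolding b_def using that(2) by (rule someI)
    moreover have "r \<in> R"
      using that R by blast
    ultimately show ?thesis
      using is_bundle_pattern_unique[OF that(2)] ne by metis
  qed
  have "R = b ` M"
    using R b pairing_has_bundle_pattern[OF pair] by (auto simp: image_iff) metis+
  then have "card (b ` M) = card M"
    using card card_pairing[OF pair fin] by simp
  then have "inj_on b M"
    using \<open>finite M\<close> by (simp add: eq_card_imp_inj_on)
  then show ?thesis
    using e e' b by (metis inj_onD)
qed

section \<open>The all-zero pattern and the root\<close>

lemma ncca_quiescent:
  assumes "ncca n f"
  shows "\<not> f (replicate n False)"
proof
  assume f: "f (replicate n False)"
  have "finite_configuration (\<lambda>_. False)"
    by (simp add: finite_configuration_def)
  then have "finite_configuration (global_function n f (\<lambda>_. False))"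
    using assms unfolding ncca_def by blast
  moreover have "global_function n f (\<lambda>_. False) = (\<lambda>_. True)"
    using f by (simp add: global_function_def map_replicate_const)
  ultimately show False
    by (simp add: finite_configuration_def)
qed

lemma bundle_sequence_step:
  assumes "bundle_sequence n f P M" and "i \<in> {1..<n}"
  shows "bundle_pattern_set_via (M (Suc i)) (P (Suc i)) (P i)"
proof -
  have "Suc i \<in> {2..n}"
    using assms(2) by auto
  then have "bundle_pattern_set_via (M (Suc i)) (P (Suc i)) (P (Suc i - 1))"
    using assms(1) unfolding bundle_sequence_def by blast
  then show ?thesis
    by simp
qed

text \<open>The all-zero pattern climbs level by level: in \<open>P k\<close> it is the bundle
  pattern of some block of \<open>M (Suc k)\<close>, and that block contains the longer all-zero
  pattern and lies in \<open>P (Suc k)\<close>.\<close>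

lemma replicate_False_level:
  assumes seq: "bundle_sequence n f P M" and i: "1 \<le> i" "i \<le> n"
    and mem: "replicate i False \<in> P i"
  shows "f (replicate n False)"
proof -
  have "replicate n False \<in> P n"
    using i(2)
  proof (induction rule: dec_induct)
    case base
    show ?case by (fact mem)
  next
    case (step k)
    then have via: "bundle_pattern_set_via (M (Suc k)) (P (Suc k)) (P k)"
      using bundle_sequence_step[OF seq, of k] i by simp
    then obtain e where "e \<in> M (Suc k)" "is_bundle_pattern (replicate k False) e"
      using step.IH unfolding bundle_pattern_set_via_def by blast
    moreover have "\<Union>(M (Suc k)) = P (Suc k)"
      using via unfolding bundle_pattern_set_via_def pairing_def partition_on_def by blast
    ultimately show ?case
      using replicate_False_mem by blast
  qed
  then show ?thesis
    using seq unfolding bundle_sequence_def value1_patterns_def by auto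
qed

text \<open>The first level has \<open>2 ^ 0\<close> patterns of length one, which leaves two
  candidates; climbing from \<open>[False]\<close> would contradict quiescence.\<close>

lemma root_level:
  assumes n: "n \<ge> 1" and ncca: "ncca n f" and seq: "bundle_sequence n f P M"
  shows "P 1 = {[True]}"
proof -
  have "P 1 \<subseteq> patterns 1" "card (P 1) = 1"
    using seq n unfolding bundle_sequence_def by force+
  then obtain p where p: "P 1 = {p}" "length p = 1"
    by (auto simp: patterns_def card_1_singleton_iff)
  have "p \<noteq> [False]"
    using replicate_False_level[OF seq, of 1] ncca_quiescent[OF ncca] n p(1) by auto
  then show ?thesis
    using p by (auto simp: length_Suc_conv)
qed

section \<open>The tree structure of the bundle graph\<close>

text \<open>Pattern length serves as the rank: it identifies the level of a vertex, and every arc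
  raises it by one.\<close>

lemma binary_tree_bundle_graph:
  assumes n: "n \<ge> 1" and seq: "bundle_sequence n f P M" and root: "P 1 = {x}"
  shows "binary_tree (with_proj (bundle_graph n P M)) x"
proof -
  let ?T = "bundle_graph n P M"
  have len: "length p = i" if "i \<in> {1..n}" "p \<in> P i" for i p
    using seq that unfolding bundle_sequence_def patterns_def by blast
  have card: "card (P i) = 2 ^ (i - 1)" if "i \<in> {1..n}" for i
    using seq that unfolding bundle_sequence_def by blast
  \<comment> \<open>A power of two is positive, whereas an infinite set has \<open>card\<close>
    equal to 0.\<close>
  have fin: "finite (P i)" if "i \<in> {1..n}" for i
    using card[OF that] by (auto intro: card_ge_0_finite)
  have via: "bundle_pattern_set_via (M (Suc i)) (P (Suc i)) (P i)" if "i \<in> {1..<n}" for i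
    using bundle_sequence_step[OF seq that] .
  have part: "partition_on (P (Suc i)) (M (Suc i))" if "i \<in> {1..<n}" for i
    using via[OF that] by (simp add: bundle_pattern_set_via_def pairing_def)
  have arcs: "parcs ?T =
      {(r, p). \<exists>i\<in>{1..<n}. r \<in> P i \<and> (\<exists>e\<in>M (Suc i). is_bundle_pattern r e \<and> p \<in> e)}"
    and verts: "pverts ?T = (\<Union>i\<in>{1..n}. P i)"
    by (simp_all add: bundle_graph_def)
  have arc_cases: "\<exists>i e. i \<in> {1..<n} \<and> r \<in> P i \<and> p \<in> P (Suc i) \<and> e \<in> M (Suc i)
      \<and> is_bundle_pattern r e \<and> p \<in> e \<and> length r = i \<and> length p = Suc i"
    if rp: "(r, p) \<in> parcs ?T" for r p
  proof -
    obtain i e where i: "i \<in> {1..<n}" "r \<in> P i" "e \<in> M (Suc i)" "is_bundle_pattern r e" "p \<in> e"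
      using rp unfolding arcs by blast
    moreover have "p \<in> P (Suc i)"
      using part i by (auto simp: partition_on_def)
    ultimately show ?thesis
      using len[of i r] len[of "Suc i" p] by auto
  qed
  have closed: "r \<in> pverts ?T \<and> p \<in> pverts ?T" if "(r, p) \<in> parcs ?T" for r p
    using arc_cases[OF that] unfolding verts by force
  have fin_verts: "finite (pverts ?T)"
    using fin by (auto simp: verts)
  have "finite (parcs ?T)"
    by (rule finite_subset[of _ "pverts ?T \<times> pverts ?T"]) (use closed fin_verts in auto)
  with fin_verts closed have fin_graph: "fin_digraph (with_proj ?T)"
    by unfold_locales auto
  have root_vert: "x \<in> pverts ?T"
    using n root by (force simp: verts)
  \<comment> \<open>The parent of \<open>v\<close> is the bundle pattern of the block containing
    \<open>v\<close>. For uniqueness, the length of \<open>v\<close> fixes the level, the partition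
    fixes the block, and the block fixes its bundle pattern.\<close>
  have in_arc: "\<exists>!a. a \<in> parcs ?T \<and> snd a = v" if v: "v \<in> pverts ?T" "v \<noteq> x" for v
  proof -
    obtain j where j: "j \<in> {1..n}" "v \<in> P j"
      using v by (auto simp: verts)
    moreover have "j \<noteq> 1"
      using j v root by auto
    ultimately have "j - 1 \<in> {1..<n}" "v \<in> P (Suc (j - 1))"
      by auto
    then obtain i where i: "i \<in> {1..<n}" "v \<in> P (Suc i)"
      by blast
    obtain e where e: "e \<in> M (Suc i)" "v \<in> e"
      using part[OF i(1)] i(2) by (auto simp: partition_on_def)
    obtain r where r: "is_bundle_pattern r e"
      using via[OF i(1)] e(1) pairing_has_bundle_pattern
      unfolding bundle_pattern_set_via_def by blast
    then have "r \<in> P i"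
      using via[OF i(1)] e(1) unfolding bundle_pattern_set_via_def by blast
    then have "(r, v) \<in> parcs ?T"
      using i e r unfolding arcs by blast
    moreover have "s = r" if arc: "(s, v) \<in> parcs ?T" for s
    proof -
      obtain k e' where k: "e' \<in> M (Suc k)" "is_bundle_pattern s e'" "v \<in> e'"
          "length v = Suc k" "length s = k" "k \<in> {1..<n}"
        using arc_cases[OF arc] by blast
      have "k = i"
        using len[of "Suc i" v] i k by auto
      then have "e' = e"
        using part[OF i(1)] e k unfolding partition_on_def disjoint_def by blast
      \<comment> \<open>Uniqueness applies because \<open>s\<close> has length
        \<open>k \<ge> 1\<close> and so is nonempty.\<close>
      then show "s = r"
        using is_bundle_pattern_unique[of s e r] k r by force
    qed
    ultimately show ?thesis
      by (metis prod.collapse snd_conv)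
  qed
  have walk: "\<exists>!w. pre_digraph.awalk (with_proj ?T) x w v" if "v \<in> pverts ?T" for v
  proof (rule ex1_awalk_from_root[where h = length])
    show "wf_digraph (with_proj ?T)"
      using fin_graph by (simp add: fin_digraph_def)
    show "length (head (with_proj ?T) a) = Suc (length (tail (with_proj ?T) a))"
      if "a \<in> arcs (with_proj ?T)" for a
      using arc_cases[of "fst a" "snd a"] that by auto
    show "length x \<le> length u" if "u \<in> verts (with_proj ?T)" for u
    proof -
      have "length x = 1"
        using len[of 1 x] n root by simp
      moreover have "1 \<le> length u"
        using that len by (force simp: verts)
      ultimately show ?thesis
        by simp
    qed
    show "\<exists>!a. a \<in> arcs (with_proj ?T) \<and> head (with_proj ?T) a = u"
      if "u \<in> verts (with_proj ?T)" "u \<noteq> x" for u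
      using in_arc[of u] that by simp
  qed (simp_all add: root_vert that)
  \<comment> \<open>By the counting argument, all arcs out of \<open>r\<close> end in one
    two-element block.\<close>
  have degree: "out_degree (with_proj ?T) r \<le> 2" for r
  proof (cases "out_arcs (with_proj ?T) r = {}")
    case False
    then obtain p where "(r, p) \<in> parcs ?T"
      by (auto simp: out_arcs_def)
    then obtain i e where i: "i \<in> {1..<n}" "e \<in> M (Suc i)" "is_bundle_pattern r e" "length r = i"
      using arc_cases by blast
    have eq: "e' = e" if "e' \<in> M (Suc i)" "is_bundle_pattern r e'" for e'
    proof (rule bundle_pattern_set_inj[OF via[OF i(1)]])
      show "finite (P (Suc i))"
        using fin i by auto
      \<comment> \<open>With \<open>i \<ge> 1\<close> the subtraction in \<open>2 ^ (i - 1)\<close>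
        is not truncated, so the size really doubles.\<close>
      show "card (P (Suc i)) = 2 * card (P i)"
        using card[of i] card[of "Suc i"] i(1) by (cases i) auto
      show "[] \<notin> P i"
        using len[of i "[]"] i(1) by auto
    qed (use that i in auto)
    have "out_arcs (with_proj ?T) r \<subseteq> Pair r ` e"
    proof
      fix a assume "a \<in> out_arcs (with_proj ?T) r"
      then obtain q where a: "a = (r, q)" "(r, q) \<in> parcs ?T"
        by (cases a) (auto simp: out_arcs_def)
      then obtain e' where "e' \<in> M (Suc i)" "is_bundle_pattern r e'" "q \<in> e'"
        using arc_cases[OF a(2)] i(4) by blast
      then show "a \<in> Pair r ` e"
        using eq a by blast
    qed
    moreover have "card e = 2"
      using i(3) by (rule card_is_bundle_pattern)
    moreover from this have "finite e"
      using card.infinite by fastforce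
    ultimately show ?thesis
      unfolding out_degree_def by (metis card_image_le finite_imageI card_mono le_trans)
  qed (simp add: out_degree_def)
  show ?thesis
    using fin_graph root_vert walk degree by (simp add: binary_tree_def)
qed

theorem theorem2:
  fixes n :: nat and f :: "bool list \<Rightarrow> bool"
    and P :: "nat \<Rightarrow> bool list set" and T :: "bool list pair_pre_digraph"
  assumes "n \<ge> 1"
    and "ncca n f"
    and "is_bundle_tree n f P T"
  shows "P 1 = {[True]} \<and> binary_tree (with_proj T) [True]"
proof -
  obtain M where seq: "bundle_sequence n f P M" and T: "T = bundle_graph n P M"
    using assms(3) by (auto simp: is_bundle_tree_def)
  have root: "P 1 = {[True]}"
    using root_level[OF assms(1,2) seq] .
  then show ?thesis
    using binary_tree_bundle_graph[OF assms(1) seq root] T by simp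
qed

end
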